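(* Let $D$ be a non-zero $n\times n$ generalized Euclidean distance matrix. Then $$\lambda(D)\prec\lambda\!\left(\frac{D+D'}{2}\right).$$
   Context: All matrices are real; a prime denotes transpose. $\mathbf{1}\in\mathbb{R}^n$ is the vector of all ones. An $n\times n$ real symmetric matrix $L$ is a generalized Laplacian matrix if $L$ is positive semidefinite and $L\mathbf{1}=0$. An $n\times n$ matrix $D=[d_{ij}]$ is a generalized Euclidean distance matrix if there exist real numbers $a,b>0$ and an $n\times n$ generalized Laplacian matrix $L=[l_{ij}]$ such that $d_{ij}=a^2 l_{ii}+b^2 l_{jj}-2ab\,l_{ij}$ for all $i,j$; all eigenvalues of such a matrix are real. For a matrix $A$ with only real eigenvalues, $\lambda(A)\in\mathbb{R}^n$ is the vector of eigenvalues of $A$ (with multiplicity) in decreasing order. For $x,y\in\mathbb{R}^n$, $x\prec y$ ($x$ is majorized by $y$) means $\sum_{i=1}^n x_i=\sum_{i=1}^n y_i$ and, for each $k=1,\dots,n-1$, the sum of the $k$ largest entries of $x$ is at most the sum of the $k$ largest entries of $y$. *)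

theory Defs
  imports Complex_Main "Jordan_Normal_Form.Char_Poly" "HOL-Library.Multiset"
begin

definition psd_mat :: "nat \<Rightarrow> real mat \<Rightarrow> bool" where
  "psd_mat n A \<longleftrightarrow> A \<in> carrier_mat n n \<and> transpose_mat A = A \<and>
     (\<forall>x \<in> carrier_vec n. x \<bullet> (A *\<^sub>v x) \<ge> 0)"

definition ones_vec :: "nat \<Rightarrow> real vec" where
  "ones_vec n = vec n (\<lambda>_. 1)"

definition gen_laplacian :: "nat \<Rightarrow> real mat \<Rightarrow> bool" where
  "gen_laplacian n L \<longleftrightarrow> psd_mat n L \<and> L *\<^sub>v ones_vec n = 0\<^sub>v n"

definition gen_edm :: "nat \<Rightarrow> real mat \<Rightarrow> bool" where
  "gen_edm n D \<longleftrightarrow> D \<in> carrier_mat n n \<and>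
     (\<exists>a b L. a > 0 \<and> b > 0 \<and> gen_laplacian n L \<and>
        (\<forall>i<n. \<forall>j<n. D $$ (i, j) =
           a\<^sup>2 * L $$ (i, i) + b\<^sup>2 * L $$ (j, j) - 2 * a * b * L $$ (i, j)))"

definition decreasing_list :: "real multiset \<Rightarrow> real list" where
  "decreasing_list M = rev (sorted_list_of_multiset M)"

(* Eigenvalues are counted with algebraic multiplicity. Only real roots of the characteristic
   polynomial are listed, so the vector has the full dimension n exactly if all eigenvalues of
   the n x n matrix are real; the dimension condition in majorized below makes this matter. *)
definition eigval_vec :: "real mat \<Rightarrow> real vec" where
  "eigval_vec A = vec_of_list (decreasing_list (proots (char_poly A)))"

definition sum_largest :: "nat \<Rightarrow> real vec \<Rightarrow> real" where
  "sum_largest k x = sum_list (take k (decreasing_list (mset (list_of_vec x))))"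

definition majorized :: "nat \<Rightarrow> real vec \<Rightarrow> real vec \<Rightarrow> bool" where
  "majorized n x y \<longleftrightarrow> x \<in> carrier_vec n \<and> y \<in> carrier_vec n \<and>
     (\<Sum>i<n. x $ i) = (\<Sum>i<n. y $ i) \<and>
     (\<forall>k \<in> {1..<n}. sum_largest k x \<le> sum_largest k y)"

end

theory Submission
  imports Defs "Jordan_Normal_Form.Schur_Decomposition"
begin

text \<open>Ky Fan: a real matrix with real spectrum has an orthogonal Schur form \<open>Q\<^sup>T A Q\<close>, whose
  symmetric part has the eigenvalues of \<open>A\<close> on its diagonal. Diagonalizing \<open>(A + A\<^sup>T) / 2\<close>
  orthogonally exhibits that diagonal as the image of \<open>\<lambda>((A + A\<^sup>T) / 2)\<close> under a doubly stochastic
  matrix, and majorization follows as in Schur's theorem. A generalized Euclidean distance matrix has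
  real spectrum because multiplying it by a suitable positive definite matrix makes it symmetric.\<close>

section \<open>Real spectrum of symmetrizable matrices\<close>

lemma real_scalar_prod_self_pos:
  fixes x :: "real vec"
  assumes "x \<in> carrier_vec n" "x \<noteq> 0\<^sub>v n"
  shows "0 < x \<bullet> x"
proof -
  have "conjugate x = x" by (intro eq_vecI) auto
  then show ?thesis using conjugate_square_greater_0_vec[OF assms(1)] assms(2) by simp
qed

lemma scalar_prod_symmetric_mat:
  fixes M :: "real mat"
  assumes M: "M \<in> carrier_mat n n" and sym: "transpose_mat M = M"
    and x: "x \<in> carrier_vec n" and y: "y \<in> carrier_vec n"
  shows "x \<bullet> (M *\<^sub>v y) = y \<bullet> (M *\<^sub>v x)"
proof -
  have "x \<bullet> (M *\<^sub>v y) = (transpose_mat M *\<^sub>v x) \<bullet> y"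
    by (rule transpose_vec_mult_scalar[OF M y x, symmetric])
  also have "\<dots> = y \<bullet> (M *\<^sub>v x)"
    unfolding sym by (rule comm_scalar_prod[of _ n]) (use M x y in auto)
  finally show ?thesis .
qed

text \<open>With \<open>v = x + iy\<close> an eigenvector of \<open>A\<^sup>T\<close> for \<open>z\<close>, comparing the two
  evaluations of the symmetric form \<open>x\<^sup>T G A\<^sup>T y\<close> gives \<open>Im z (x\<^sup>T G x + y\<^sup>T G y) = 0\<close>.\<close>

lemma symmetrizable_char_poly_roots_real:
  fixes A G :: "real mat"
  assumes A: "A \<in> carrier_mat n n" and G: "G \<in> carrier_mat n n"
    and symG: "transpose_mat G = G"
    and posG: "\<And>x. x \<in> carrier_vec n \<Longrightarrow> x \<noteq> 0\<^sub>v n \<Longrightarrow> 0 < x \<bullet> (G *\<^sub>v x)"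
    and symAG: "transpose_mat (A * G) = A * G"
    and root: "poly (char_poly (map_mat complex_of_real A)) z = 0"
  shows "Im z = 0"
proof -
  \<comment> \<open>The transpose is used because symmetry of \<open>A * G\<close> and of
    \<open>G\<close> reads \<open>A * G = G * transpose_mat A\<close>: the form can then be
    evaluated by letting \<open>?T\<close> act on \<open>x\<close> and \<open>y\<close>. Its
    spectrum is that of \<open>A\<close>.\<close>
  let ?T = "transpose_mat A"
  let ?C = "map_mat complex_of_real ?T"
  have T: "?T \<in> carrier_mat n n" and C: "?C \<in> carrier_mat n n"
    using A by auto
  have "?C = transpose_mat (map_mat complex_of_real A)"
    using A by auto
  then have "char_poly ?C = char_poly (map_mat complex_of_real A)"
    using A by (metis char_poly_transpose_mat map_carrier_mat)
  with root have "eigenvalue ?C z"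
    using eigenvalue_root_char_poly[OF C] by simp
  then obtain v where v: "v \<in> carrier_vec n" "v \<noteq> 0\<^sub>v n" and ev: "?C *\<^sub>v v = z \<cdot>\<^sub>v v"
    using C unfolding eigenvalue_def eigenvector_def by auto
  define x where "x = map_vec Re v"
  define y where "y = map_vec Im v"
  have x: "x \<in> carrier_vec n" and y: "y \<in> carrier_vec n"
    using v by (auto simp: x_def y_def)
  have comp: "(\<Sum>j = 0..<n. complex_of_real (?T $$ (i, j)) * v $ j) = z * v $ i" if "i < n" for i
    using arg_cong[OF ev, of "\<lambda>w. w $ i"] that A v
    by (simp add: scalar_prod_def)
  have Tx: "?T *\<^sub>v x = Re z \<cdot>\<^sub>v x - Im z \<cdot>\<^sub>v y"
  proof (rule eq_vecI)
    fix i assume "i < dim_vec (Re z \<cdot>\<^sub>v x - Im z \<cdot>\<^sub>v y)"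
    then have i: "i < n" using y by simp
    show "(?T *\<^sub>v x) $ i = (Re z \<cdot>\<^sub>v x - Im z \<cdot>\<^sub>v y) $ i"
      using arg_cong[OF comp[OF i], of Re] i A v by (simp add: scalar_prod_def x_def y_def)
  qed (use A y in auto)
  have Ty: "?T *\<^sub>v y = Re z \<cdot>\<^sub>v y + Im z \<cdot>\<^sub>v x"
  proof (rule eq_vecI)
    fix i assume "i < dim_vec (Re z \<cdot>\<^sub>v y + Im z \<cdot>\<^sub>v x)"
    then have i: "i < n" using x by simp
    show "(?T *\<^sub>v y) $ i = (Re z \<cdot>\<^sub>v y + Im z \<cdot>\<^sub>v x) $ i"
      using arg_cong[OF comp[OF i], of Im] i A v by (simp add: scalar_prod_def x_def y_def)
  qed (use A x in auto)
  have GT: "G * ?T = A * G"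
    using transpose_mult[OF A G] symG symAG by simp
  have form: "p \<bullet> (A * G *\<^sub>v q) = p \<bullet> (G *\<^sub>v (?T *\<^sub>v q))" if "q \<in> carrier_vec n" for p q
    using that by (simp add: GT[symmetric] assoc_mult_mat_vec[OF G T])
  have Gx: "G *\<^sub>v x \<in> carrier_vec n" and Gy: "G *\<^sub>v y \<in> carrier_vec n"
    using G x y by auto
  have "x \<bullet> (A * G *\<^sub>v y) = Re z * (x \<bullet> (G *\<^sub>v y)) + Im z * (x \<bullet> (G *\<^sub>v x))"
    unfolding form[OF y] Ty using x y G Gx Gy
    by (simp add: mult_add_distrib_mat_vec[of _ n n] mult_mat_vec[of _ n n]
        scalar_prod_add_distrib[of _ n])
  moreover have "y \<bullet> (A * G *\<^sub>v x) = Re z * (y \<bullet> (G *\<^sub>v x)) - Im z * (y \<bullet> (G *\<^sub>v y))"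
    unfolding form[OF x] Tx using x y G Gx Gy
    by (simp add: mult_minus_distrib_mat_vec[of _ n n] mult_mat_vec[of _ n n]
        scalar_prod_minus_distrib[of _ n])
  moreover have "x \<bullet> (A * G *\<^sub>v y) = y \<bullet> (A * G *\<^sub>v x)"
    using A G x y symAG by (intro scalar_prod_symmetric_mat[of _ n]) auto
  moreover have "x \<bullet> (G *\<^sub>v y) = y \<bullet> (G *\<^sub>v x)"
    using G x y symG by (intro scalar_prod_symmetric_mat[of _ n]) auto
  ultimately have zero: "Im z * (x \<bullet> (G *\<^sub>v x) + y \<bullet> (G *\<^sub>v y)) = 0"
    by (simp add: algebra_simps)
  have nonneg: "0 \<le> w \<bullet> (G *\<^sub>v w)" if "w \<in> carrier_vec n" for w
  proof (cases "w = 0\<^sub>v n")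
    case True
    then show ?thesis using G by simp
  qed (use posG[OF that] in auto)
  have "x \<noteq> 0\<^sub>v n \<or> y \<noteq> 0\<^sub>v n"
  proof (rule ccontr)
    assume "\<not> ?thesis"
    then have "Re (v $ i) = 0 \<and> Im (v $ i) = 0" if "i < n" for i
      using that v(1) by (metis carrier_vecD index_map_vec(1) index_zero_vec(1) x_def y_def)
    then have "v = 0\<^sub>v n"
      using v(1) by (intro eq_vecI) (auto simp: complex_eq_iff)
    with v(2) show False by simp
  qed
  then have "x \<bullet> (G *\<^sub>v x) + y \<bullet> (G *\<^sub>v y) > 0"
    using posG x y nonneg by (metis add_nonneg_pos add_pos_nonneg)
  with zero show ?thesis by simp
qed

text \<open>Over the complex numbers the polynomial splits, and all its roots are real. The complex
  factorization is therefore the image of a real one, and the embedding of real into complex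
  polynomials is injective.\<close>

lemma symmetrizable_char_poly_splits:
  fixes A G :: "real mat"
  assumes A: "A \<in> carrier_mat n n" and G: "G \<in> carrier_mat n n"
    and symG: "transpose_mat G = G"
    and posG: "\<And>x. x \<in> carrier_vec n \<Longrightarrow> x \<noteq> 0\<^sub>v n \<Longrightarrow> 0 < x \<bullet> (G *\<^sub>v x)"
    and symAG: "transpose_mat (A * G) = A * G"
  shows "\<exists>es. char_poly A = (\<Prod>e\<leftarrow>es. [:- e, 1:])"
proof -
  let ?C = "map_mat complex_of_real A"
  interpret of_real_poly: map_poly_inj_comm_ring_hom complex_of_real ..
  have C: "?C \<in> carrier_mat n n" using A by auto
  obtain as where as: "char_poly ?C = (\<Prod>a\<leftarrow>as. [:- a, 1:])"
    using char_poly_factorized[OF C] by auto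
  have real: "complex_of_real (Re a) = a" if "a \<in> set as" for a
  proof -
    have "poly (char_poly ?C) a = 0"
      using that unfolding as by (auto simp: poly_prod_list prod_list_zero_iff)
    from symmetrizable_char_poly_roots_real[OF A G symG posG symAG this]
    show ?thesis by (simp add: complex_eq_iff)
  qed
  have "map_poly complex_of_real (char_poly A) = (\<Prod>a\<leftarrow>as. [:- a, 1:])"
    using as of_real_hom.char_poly_hom[OF A] by metis
  also have "\<dots> = (\<Prod>a\<leftarrow>as. map_poly complex_of_real [:- Re a, 1:])"
    using real by (intro arg_cong[of _ _ prod_list] map_cong) auto
  also have "\<dots> = map_poly complex_of_real (\<Prod>e\<leftarrow>map Re as. [:- e, 1:])"
    by (simp add: of_real_poly.hom_prod_list o_def)
  finally show ?thesis
    using of_real_poly.injectivity by blast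
qed

section \<open>Orthogonal Schur form over the reals\<close>

text \<open>Complete \<open>v\<close> to a basis, apply Gram-Schmidt, which keeps the first vector,
  and normalize the result.\<close>

lemma orthogonal_completion:
  fixes v :: "real vec"
  assumes v: "v \<in> carrier_vec n" and unit: "v \<bullet> v = 1"
  shows "\<exists>W \<in> carrier_mat n n. transpose_mat W * W = 1\<^sub>m n \<and> col W 0 = v"
proof -
  interpret cof_vec_space n "TYPE(real)" .
  have v0: "v \<noteq> 0\<^sub>v n" using unit by auto
  then have n: "n \<noteq> 0" using v by auto
  define b where "b = basis_completion v"
  define ws where "ws = gram_schmidt n b"
  from basis_completion[OF v v0, folded b_def]
  have b: "distinct b" "\<not> lin_dep (set b)" "set b \<subseteq> carrier_vec n" "hd b = v" "length b = n"
    by auto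
  from b(4,5) n obtain vs where bv: "b = v # vs" by (cases b) auto
  from gram_schmidt_result[OF b(3) b(1) b(2) refl, folded ws_def]
  have ws: "set ws \<subseteq> carrier_vec n" "corthogonal ws" "length ws = n"
    by (auto simp: b(5))
  have hd_ws: "ws ! 0 = v"
    using gram_schmidt_hd[OF v, of vs, folded bv ws_def] ws(3) n by (metis hd_conv_nth list.size(3))
  have ws_nth: "ws ! i \<in> carrier_vec n" if "i < n" for i
    using that ws by auto
  have conj: "conjugate w = w" for w :: "real vec"
    by (intro eq_vecI) auto
  \<comment> \<open>Conjugation is trivial on real vectors, so this is ordinary orthogonality. The
    case \<open>i = j\<close> also shows that no \<open>ws ! i\<close> vanishes, which makes the
    later division by norms legitimate.\<close>
  have orth: "ws ! i \<bullet> ws ! j = 0 \<longleftrightarrow> i \<noteq> j" if "i < n" "j < n" for i j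
    using corthogonalD[OF ws(2)] that ws(3) by (simp add: conj)
  have pos: "ws ! i \<bullet> ws ! i > 0" if "i < n" for i
    using orth[OF that that] ws_nth[OF that]
    by (intro real_scalar_prod_self_pos[of _ n]) auto
  define us where "us = map (\<lambda>w. (1 / sqrt (w \<bullet> w)) \<cdot>\<^sub>v w) ws"
  have us: "set us \<subseteq> carrier_vec n" "length us = n"
    using ws by (auto simp: us_def)
  have us_nth: "us ! i = (1 / sqrt (ws ! i \<bullet> ws ! i)) \<cdot>\<^sub>v ws ! i" if "i < n" for i
    using that ws(3) by (simp add: us_def)
  define W where "W = mat_of_cols n us"
  have W: "W \<in> carrier_mat n n"
    using us unfolding W_def by auto
  have col: "col W i = us ! i" if "i < n" for i
    unfolding W_def using us that by (intro col_mat_of_cols) auto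
  have "transpose_mat W * W = 1\<^sub>m n"
  proof (rule eq_matI)
    fix i j assume "i < dim_row (1\<^sub>m n :: real mat)" "j < dim_col (1\<^sub>m n :: real mat)"
    then have ij: "i < n" "j < n" by auto
    then have "(transpose_mat W * W) $$ (i, j) = us ! i \<bullet> us ! j"
      using W by (simp add: col)
    also have "\<dots> = (ws ! i \<bullet> ws ! j) / (sqrt (ws ! i \<bullet> ws ! i) * sqrt (ws ! j \<bullet> ws ! j))"
      using ij ws_nth[OF ij(1)] ws_nth[OF ij(2)] by (simp add: us_nth)
    also have "\<dots> = 1\<^sub>m n $$ (i, j)"
      using ij orth[OF ij] pos[OF ij(1)] by auto
    finally show "(transpose_mat W * W) $$ (i, j) = 1\<^sub>m n $$ (i, j)" .
  qed (use W in auto)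
  \<comment> \<open>Normalization does not change the first vector, since \<open>v\<close> is
    already a unit vector.\<close>
  moreover have "col W 0 = v"
    using col[of 0] us_nth[of 0] n hd_ws unit by simp
  ultimately show ?thesis using W by blast
qed

lemma eigenvalue_unit_eigenvector:
  fixes A :: "real mat"
  assumes A: "A \<in> carrier_mat n n" and e: "eigenvalue A e"
  shows "\<exists>v \<in> carrier_vec n. v \<bullet> v = 1 \<and> A *\<^sub>v v = e \<cdot>\<^sub>v v"
proof -
  obtain u where u: "u \<in> carrier_vec n" "u \<noteq> 0\<^sub>v n" "A *\<^sub>v u = e \<cdot>\<^sub>v u"
    using e A unfolding eigenvalue_def eigenvector_def by auto
  have "u \<bullet> u > 0"
    using u(1,2) by (rule real_scalar_prod_self_pos)
  define v where "v = (1 / sqrt (u \<bullet> u)) \<cdot>\<^sub>v u"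
  have "v \<bullet> v = 1"
    using u(1) \<open>u \<bullet> u > 0\<close> by (simp add: v_def)
  moreover have "A *\<^sub>v v = e \<cdot>\<^sub>v v"
    using A u by (simp add: v_def mult_mat_vec[of _ n n] smult_smult_assoc mult.commute)
  moreover have "v \<in> carrier_vec n" using u by (simp add: v_def)
  ultimately show ?thesis by blast
qed

text \<open>Deflation by induction on the list of eigenvalues: a unit eigenvector for the first one
  becomes the first column of an orthogonal matrix, and the remaining block is handled by the
  induction hypothesis. The eigenvalues appear on the diagonal in the prescribed order
  \<open>es\<close>.\<close>

lemma orthogonal_schur:
  fixes A :: "real mat"
  assumes "A \<in> carrier_mat n n" and "char_poly A = (\<Prod>e\<leftarrow>es. [:- e, 1:])"
  shows "\<exists>Q \<in> carrier_mat n n. transpose_mat Q * Q = 1\<^sub>m n \<and>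
    upper_triangular (transpose_mat Q * A * Q) \<and> diag_mat (transpose_mat Q * A * Q) = es"
  using assms
proof (induction es arbitrary: n A)
  case Nil
  with degree_monic_char_poly[of A n] have "n = 0" by simp
  then show ?case using Nil
    by (intro bexI[of _ "1\<^sub>m 0"]) (auto simp: diag_mat_def)
next
  case (Cons e es n A)
  note A = Cons.prems(1)
  have cp: "char_poly A = [:- e, 1:] * (\<Prod>e\<leftarrow>es. [:- e, 1:])"
    using Cons.prems(2) by simp
  have "eigenvalue A e"
    unfolding eigenvalue_root_char_poly[OF A] cp by simp
  then obtain v where v: "v \<in> carrier_vec n" "v \<bullet> v = 1" "A *\<^sub>v v = e \<cdot>\<^sub>v v"
    using eigenvalue_unit_eigenvector[OF A] by auto
  obtain m where n: "n = Suc m"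
    using v(1,2) by (cases n) (auto simp: scalar_prod_def)
  obtain W where W: "W \<in> carrier_mat n n" and WW: "transpose_mat W * W = 1\<^sub>m n"
    and W0: "col W 0 = v"
    using orthogonal_completion[OF v(1,2)] by blast
  define B where "B = transpose_mat W * A * W"
  have B: "B \<in> carrier_mat n n" using W A by (simp add: B_def)
  \<comment> \<open>The first column of \<open>B\<close> is the image of
    \<open>A *\<^sub>v v = e \<cdot>\<^sub>v v\<close> under \<open>transpose_mat W\<close>; as
    \<open>v\<close> is the first of the orthonormal columns of \<open>W\<close>, only the top entry
    \<open>e\<close> survives.\<close>
  have col_B: "B $$ (i, 0) = (if i = 0 then e else 0)" if i: "i < n" for i
  proof -
    have "B $$ (i, 0) = (transpose_mat W * (A * W)) $$ (i, 0)"
      using W A unfolding B_def by (simp add: assoc_mult_mat[of _ n n _ n _ n])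
    also have "\<dots> = row (transpose_mat W) i \<bullet> col (A * W) 0"
      by (rule index_mult_mat) (use W i n in auto)
    also have "\<dots> = col W i \<bullet> (e \<cdot>\<^sub>v v)"
      using col_mult2[OF A W, of 0] W i n v(3) W0 by simp
    also have "\<dots> = e * (col W i \<bullet> col W 0)"
      unfolding W0 by (rule scalar_prod_smult_distrib[of _ n]) (use W v(1) i in auto)
    also have "col W i \<bullet> col W 0 = (transpose_mat W * W) $$ (i, 0)"
      using W i n by simp
    finally show ?thesis unfolding WW using i n by simp
  qed
  obtain B1 B2 B0 B3 where split: "split_block B 1 1 = (B1, B2, B0, B3)"
    by (cases "split_block B 1 1") auto
  have "dim_row B = 1 + m" "dim_col B = 1 + m" using B n by auto
  note blocks = split_block[OF split this]
  have B1: "B1 = mat 1 1 (\<lambda>_. e)"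
    using split col_B[of 0] n by (auto simp: split_block_def Let_def)
  have B0: "B0 = 0\<^sub>m m 1"
    using split col_B B n by (auto simp: split_block_def Let_def)
  have B_block: "B = four_block_mat B1 B2 (0\<^sub>m m 1) B3"
    using blocks(5) B0 by simp
  \<comment> \<open>Similarity preserves the characteristic polynomial, and the block form splits
    off the factor of \<open>e\<close>. Cancelling it leaves the linear factors over
    \<open>es\<close> for \<open>B3\<close>, as the induction hypothesis requires.\<close>
  have "inverts_mat W (transpose_mat W)"
    using mat_mult_left_right_inverse[OF _ W WW] W by (simp add: inverts_mat_def)
  then have "similar_mat_wit B A (transpose_mat W) W"
    unfolding B_def using W A WW
    by (intro similar_mat_witI[of _ _ n]) (auto simp: inverts_mat_def)
  then have "similar_mat B A" unfolding similar_mat_def by blast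
  then have "char_poly B = char_poly A" by (rule char_poly_similar)
  moreover have "char_poly B = char_poly B1 * char_poly B3"
    unfolding B_block by (rule char_poly_four_block_zeros_col) (use blocks in auto)
  moreover have "char_poly B1 = [:- e, 1:]"
    by (simp add: B1 char_poly_defs det_def sign_def)
  ultimately have "char_poly B3 = (\<Prod>e\<leftarrow>es. [:- e, 1:])"
    using cp by (metis mult_cancel_left pCons_eq_0_iff zero_neq_one)
  from Cons.IH[OF blocks(4) this] obtain P where P: "P \<in> carrier_mat m m"
    and PP: "transpose_mat P * P = 1\<^sub>m m"
    and ut: "upper_triangular (transpose_mat P * B3 * P)"
    and diag: "diag_mat (transpose_mat P * B3 * P) = es"
    by blast
  \<comment> \<open>Padding \<open>P\<close> by a corner \<open>1\<close> leaves \<open>B1\<close>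
    and the zero column untouched while triangularizing \<open>B3\<close>. The orthogonal matrix for
    \<open>A\<close> is then \<open>W * R\<close>.\<close>
  define R where "R = four_block_mat (1\<^sub>m 1) (0\<^sub>m 1 m) (0\<^sub>m m 1) P"
  have R: "R \<in> carrier_mat n n" using P n by (auto simp: R_def)
  have RT: "transpose_mat R = four_block_mat (1\<^sub>m 1) (0\<^sub>m 1 m) (0\<^sub>m m 1) (transpose_mat P)"
    unfolding R_def by (subst transpose_four_block_mat) (use P in auto)
  have "transpose_mat R * R = four_block_mat (1\<^sub>m 1) (0\<^sub>m 1 m) (0\<^sub>m m 1) (1\<^sub>m m)"
    unfolding RT unfolding R_def
    by (subst mult_four_block_mat) (use P PP in auto)
  then have RR: "transpose_mat R * R = 1\<^sub>m n" by (simp add: n)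
  have RBR: "transpose_mat R * B * R
      = four_block_mat B1 (B2 * P) (0\<^sub>m m 1) (transpose_mat P * B3 * P)"
    unfolding RT B_block unfolding R_def
    using P blocks(1,2,4) by (simp add: mult_four_block_mat[of _ 1 1 _ m _ m _ _ 1 _ m])
  have B1c: "B1 \<in> carrier_mat 1 1" and B3c: "transpose_mat P * B3 * P \<in> carrier_mat m m"
    using blocks P by auto
  have "upper_triangular B1" by (auto simp: B1)
  then have "upper_triangular (transpose_mat R * B * R)"
    unfolding RBR using upper_triangular_four_block[OF B1c B3c _ ut] by blast
  moreover have "diag_mat (transpose_mat R * B * R) = e # es"
    unfolding RBR diag_four_block_mat[OF B1c B3c] diag by (simp add: B1 diag_mat_def)
  moreover have "transpose_mat (W * R) * A * (W * R) = transpose_mat R * B * R"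
    unfolding B_def transpose_mult[OF W R] using W R A
    by (simp add: assoc_mult_mat[of _ n n _ n _ n])
  moreover have "transpose_mat (W * R) * (W * R) = transpose_mat R * (transpose_mat W * W) * R"
    unfolding transpose_mult[OF W R] using W R
    by (simp add: assoc_mult_mat[of _ n n _ n _ n])
  then have "transpose_mat (W * R) * (W * R) = 1\<^sub>m n"
    using WW RR R by simp
  moreover have "W * R \<in> carrier_mat n n" using W R by simp
  ultimately show ?case by metis
qed

lemma transpose_congruence:
  fixes A :: "real mat"
  assumes A: "A \<in> carrier_mat n n" and Q: "Q \<in> carrier_mat n n"
  shows "transpose_mat (transpose_mat Q * A * Q) = transpose_mat Q * transpose_mat A * Q"
proof -
  have "transpose_mat (transpose_mat Q * A * Q) = transpose_mat Q * transpose_mat (transpose_mat Q * A)"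
    by (rule transpose_mult[of _ n n _ n]) (use A Q in auto)
  also have "transpose_mat (transpose_mat Q * A) = transpose_mat A * Q"
    using transpose_mult[of "transpose_mat Q" n n A n] A Q by simp
  finally show ?thesis using A Q by (simp add: assoc_mult_mat[of _ n n _ n _ n])
qed

section \<open>Doubly stochastic averages and the diagonal of the symmetric part\<close>

text \<open>The left side is a weighted sum of the \<open>b j\<close> with weights in
  \<open>[0, 1]\<close> of total mass \<open>k\<close>. It is largest when all the mass sits on the
  \<open>k\<close> largest values, which come first.\<close>

lemma doubly_stochastic_partial_sum_le:
  fixes c :: "nat \<Rightarrow> nat \<Rightarrow> real" and b :: "nat \<Rightarrow> real"
  assumes nonneg: "\<And>i j. i < n \<Longrightarrow> j < n \<Longrightarrow> 0 \<le> c i j"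
    and rows: "\<And>i. i < n \<Longrightarrow> (\<Sum>j<n. c i j) = 1"
    and cols: "\<And>j. j < n \<Longrightarrow> (\<Sum>i<n. c i j) = 1"
    and mono: "\<And>i j. i \<le> j \<Longrightarrow> j < n \<Longrightarrow> b j \<le> b i"
    and k: "k \<le> n"
  shows "(\<Sum>i<k. \<Sum>j<n. c i j * b j) \<le> (\<Sum>j<k. b j)"
proof (cases "k = 0")
  case False
  \<comment> \<open>The pivot \<open>p\<close> is the \<open>k\<close>-th largest value, whence the
    separate case \<open>k = 0\<close>. Since the weights \<open>d j\<close> sum to
    \<open>k\<close>, subtracting \<open>p\<close> from every \<open>b j\<close> lowers both sides
    by \<open>real k * p\<close>; afterwards the terms before \<open>k\<close> are nonnegative,
    where \<open>d j \<le> 1\<close> helps, and the others nonpositive, where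
    \<open>0 \<le> d j\<close> helps.\<close>
  define p where "p = b (k - 1)"
  define d where "d j = (\<Sum>i<k. c i j)" for j
  have d_nonneg: "0 \<le> d j" if "j < n" for j
    unfolding d_def using that k by (intro sum_nonneg nonneg) auto
  have d_le: "d j \<le> 1" if "j < n" for j
    unfolding cols[OF that, symmetric] d_def using that k by (intro sum_mono2 nonneg) auto
  have sum_d: "(\<Sum>j<n. d j) = real k"
  proof -
    have "(\<Sum>j<n. d j) = (\<Sum>i<k. \<Sum>j<n. c i j)"
      unfolding d_def by (rule sum.swap)
    also have "\<dots> = (\<Sum>i<k. 1)"
      using rows k by (intro sum.cong) auto
    finally show ?thesis by simp
  qed
  have split: "(\<Sum>j<n. f j) = (\<Sum>j<k. f j) + (\<Sum>j=k..<n. f j)" for f :: "nat \<Rightarrow> real"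
    using k by (simp add: lessThan_atLeast0 sum.atLeastLessThan_concat)
  have "(\<Sum>i<k. \<Sum>j<n. c i j * b j) = (\<Sum>j<n. d j * b j)"
    unfolding d_def by (subst sum.swap) (simp add: sum_distrib_right)
  also have "\<dots> = (\<Sum>j<n. d j * (b j - p)) + real k * p"
    by (simp add: sum_d[symmetric] sum_distrib_right right_diff_distrib sum_subtractf)
  also have "(\<Sum>j<n. d j * (b j - p)) \<le> (\<Sum>j<k. b j - p)"
  proof -
    have "(\<Sum>j<k. d j * (b j - p)) \<le> (\<Sum>j<k. b j - p)"
    proof (rule sum_mono)
      fix j assume "j \<in> {..<k}"
      then show "d j * (b j - p) \<le> b j - p"
        using d_le[of j] mono[of j "k - 1"] k mult_right_mono[of "d j" 1 "b j - p"]
        by (simp add: p_def)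
    qed
    moreover have "(\<Sum>j=k..<n. d j * (b j - p)) \<le> 0"
      using mono[of "k - 1"] False
      by (intro sum_nonpos mult_nonneg_nonpos d_nonneg) (auto simp: p_def)
    ultimately show ?thesis unfolding split by simp
  qed
  finally show ?thesis by (simp add: sum_subtractf)
qed simp

text \<open>The squared entries of an orthogonal matrix form a doubly stochastic matrix: these sums
  are the diagonal entries of \<open>transpose_mat R * R\<close> and
  \<open>R * transpose_mat R\<close>, and for square matrices a left inverse is also a right
  inverse.\<close>

lemma orthogonal_mat_sum_squares:
  fixes R :: "real mat"
  assumes R: "R \<in> carrier_mat n n" and RR: "transpose_mat R * R = 1\<^sub>m n"
  shows "\<And>j. j < n \<Longrightarrow> (\<Sum>i<n. (R $$ (i, j))\<^sup>2) = 1"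
    and "\<And>i. i < n \<Longrightarrow> (\<Sum>j<n. (R $$ (i, j))\<^sup>2) = 1"
proof -
  have RR': "R * transpose_mat R = 1\<^sub>m n"
    using mat_mult_left_right_inverse[OF _ R RR] R by simp
  show "(\<Sum>i<n. (R $$ (i, j))\<^sup>2) = 1" if "j < n" for j
    using arg_cong[OF RR, of "\<lambda>M. M $$ (j, j)"] R that
    by (simp add: scalar_prod_def power2_eq_square lessThan_atLeast0)
  show "(\<Sum>j<n. (R $$ (i, j))\<^sup>2) = 1" if "i < n" for i
    using arg_cong[OF RR', of "\<lambda>M. M $$ (i, i)"] R that
    by (simp add: scalar_prod_def power2_eq_square lessThan_atLeast0)
qed

text \<open>A matrix and its symmetric part have the same diagonal, so in a Schur basis of
  \<open>A\<close> the symmetric part has diagonal \<open>es\<close>. Expanding it in its own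
  orthonormal eigenbasis turns each diagonal entry into an average of \<open>fs\<close>.\<close>

lemma schur_ky_fan_doubly_stochastic:
  fixes A :: "real mat"
  assumes A: "A \<in> carrier_mat n n"
    and es: "char_poly A = (\<Prod>e\<leftarrow>es. [:- e, 1:])"
    and fs: "char_poly ((1 / 2) \<cdot>\<^sub>m (A + transpose_mat A)) = (\<Prod>e\<leftarrow>fs. [:- e, 1:])"
  shows "\<exists>R \<in> carrier_mat n n. transpose_mat R * R = 1\<^sub>m n \<and>
    (\<forall>i<n. es ! i = (\<Sum>j<n. (R $$ (j, i))\<^sup>2 * fs ! j))"
proof -
  define S where "S = (1 / 2) \<cdot>\<^sub>m (A + transpose_mat A)"
  have S: "S \<in> carrier_mat n n" using A by (simp add: S_def)
  have symS: "transpose_mat S = S"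
    using A by (intro eq_matI) (auto simp: S_def)
  obtain Q where Q: "Q \<in> carrier_mat n n" and QQ: "transpose_mat Q * Q = 1\<^sub>m n"
    and diagQ: "diag_mat (transpose_mat Q * A * Q) = es"
    using orthogonal_schur[OF A es] by blast
  obtain P where P: "P \<in> carrier_mat n n" and PP: "transpose_mat P * P = 1\<^sub>m n"
    and utP: "upper_triangular (transpose_mat P * S * P)"
    and diagP: "diag_mat (transpose_mat P * S * P) = fs"
    using orthogonal_schur[OF S fs[folded S_def]] by blast
  define L where "L = transpose_mat P * S * P"
  define T where "T = transpose_mat Q * A * Q"
  have L: "L \<in> carrier_mat n n" and T: "T \<in> carrier_mat n n"
    using P Q S A by (auto simp: L_def T_def)
  have symL: "transpose_mat L = L"
    unfolding L_def transpose_congruence[OF S P] symS ..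
  \<comment> \<open>An upper triangular symmetric matrix is diagonal, so the Schur form of
    \<open>S\<close> is already its spectral decomposition.\<close>
  have L_entry: "L $$ (i, j) = (if i = j then fs ! i else 0)" if "i < n" "j < n" for i j
  proof -
    have zero: "L $$ (i, j) = 0" if "j < i" "i < n" for i j
      using utP that L unfolding L_def[symmetric] by auto
    have "L $$ (i, j) = L $$ (j, i)" 
      using symL L that by (metis carrier_matD index_transpose_mat(1))
    moreover have "L $$ (i, i) = fs ! i"
      unfolding diagP[symmetric] L_def[symmetric] using L that by (simp add: diag_mat_def)
    ultimately show ?thesis
      using zero[of i j] zero[of j i] that by (cases i j rule: linorder_cases) auto
  qed
  have PP': "P * transpose_mat P = 1\<^sub>m n"
    using mat_mult_left_right_inverse[OF _ P PP] P by simp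
  \<comment> \<open>The columns of \<open>R\<close> are the coordinates of the Schur basis of
    \<open>A\<close> in the eigenbasis of \<open>S\<close>.\<close>
  define R where "R = transpose_mat P * Q"
  have R: "R \<in> carrier_mat n n" using P Q by (simp add: R_def)
  have RT: "transpose_mat R = transpose_mat Q * P"
    using transpose_mult[of "transpose_mat P" n n Q n] P Q by (simp add: R_def)
  have "transpose_mat R * R = transpose_mat Q * (P * transpose_mat P) * Q"
    unfolding RT unfolding R_def using P Q by (simp add: assoc_mult_mat[of _ n n _ n _ n])
  then have RR: "transpose_mat R * R = 1\<^sub>m n"
    using PP' QQ Q by simp
  have "transpose_mat R * L * R
      = transpose_mat Q * ((P * transpose_mat P) * S * (P * transpose_mat P)) * Q"
    unfolding RT unfolding R_def L_def using P Q S
    by (simp add: assoc_mult_mat[of _ n n _ n _ n])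
  then have RLR: "transpose_mat R * L * R = transpose_mat Q * S * Q"
    using PP' S by simp
  \<comment> \<open>Congruence by \<open>Q\<close> commutes with transposition, so it carries the
    symmetric part of \<open>A\<close> to the symmetric part of \<open>T\<close>.\<close>
  have "transpose_mat Q * S * Q
      = (1 / 2) \<cdot>\<^sub>m (T + transpose_mat T)"
    unfolding T_def transpose_congruence[OF A Q] unfolding S_def using A Q
    by (simp add: mult_smult_distrib[of _ n n _ n] mult_smult_assoc_mat[of _ n n _ n]
        mult_add_distrib_mat[of _ n n _ n] add_mult_distrib_mat[of _ n n _ _ n])
  then have QSQ: "(transpose_mat Q * S * Q) $$ (i, i) = es ! i" if "i < n" for i
    using that T unfolding diagQ[symmetric] T_def[symmetric] by (simp add: diag_mat_def)
  have "es ! i = (\<Sum>j<n. (R $$ (j, i))\<^sup>2 * fs ! j)" if i: "i < n" for i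
  proof -
    have LR: "(L * R) $$ (j, i) = fs ! j * R $$ (j, i)" if j: "j < n" for j
    proof -
      have "(L * R) $$ (j, i) = (\<Sum>k = 0..<n. L $$ (j, k) * R $$ (k, i))"
        using L R i j by (simp add: scalar_prod_def)
      also have "\<dots> = (\<Sum>k = 0..<n. if k = j then fs ! j * R $$ (j, i) else 0)"
        using j by (intro sum.cong) (auto simp: L_entry)
      finally show ?thesis using j by simp
    qed
    have RT_mult: "(transpose_mat R * M) $$ (i, i) = (\<Sum>j = 0..<n. R $$ (j, i) * M $$ (j, i))"
      if "M \<in> carrier_mat n n" for M
      using R i that by (simp add: scalar_prod_def)
    have "es ! i = (transpose_mat R * (L * R)) $$ (i, i)"
      unfolding QSQ[OF i, symmetric] RLR[symmetric] using R L
      by (simp add: assoc_mult_mat[of _ n n _ n _ n])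
    also have "\<dots> = (\<Sum>j = 0..<n. R $$ (j, i) * (L * R) $$ (j, i))"
      by (rule RT_mult) (use R L in simp)
    also have "\<dots> = (\<Sum>j<n. (R $$ (j, i))\<^sup>2 * fs ! j)"
      by (intro sum.cong) (auto simp: LR power2_eq_square)
    finally show ?thesis .
  qed
  with R RR show ?thesis by blast
qed

section \<open>Sorted eigenvalue lists and majorization\<close>

lemma proots_linear_factors: "proots (\<Prod>e\<leftarrow>es. [:- e, 1:]) = mset (es :: real list)"
  by (induction es) (simp_all add: proots_mult prod_list_zero_iff image_iff del: mult_pCons_left)

lemma decreasing_list_mset:
  assumes "sorted_wrt (\<ge>) es"
  shows "decreasing_list (mset es) = es"
proof -
  have "sorted (rev es)" using assms by (simp add: sorted_wrt_rev)
  then have "sort (rev es) = rev es" by (rule sort_key_id_if_sorted[of "\<lambda>x. x", simplified])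
  then have "sorted_list_of_multiset (mset (rev es)) = rev es"
    by (simp only: sorted_list_of_multiset_mset)
  then show ?thesis by (simp add: decreasing_list_def)
qed

text \<open>The degree of the characteristic polynomial forces \<open>n\<close> linear factors,
  which gives the dimension condition in \<open>majorized\<close>. Sorting the roots does not change
  their product and yields the list behind \<open>eigval_vec\<close>.\<close>

lemma eigval_vec_split:
  assumes A: "A \<in> carrier_mat n n"
    and "\<exists>es. char_poly A = (\<Prod>e\<leftarrow>es. [:- e, 1:])"
  shows "\<exists>es. char_poly A = (\<Prod>e\<leftarrow>es. [:- e, 1:]) \<and> length es = n \<and> sorted_wrt (\<ge>) es \<and>
    eigval_vec A = vec_of_list es"
proof -
  obtain ds where ds: "char_poly A = (\<Prod>e\<leftarrow>ds. [:- e, 1:])" using assms by blast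
  define es where "es = rev (sort ds)"
  have "mset es = mset ds" by (simp add: es_def)
  then have "char_poly A = (\<Prod>e\<leftarrow>es. [:- e, 1:])"
    unfolding ds by (metis mset_map prod_mset_prod_list)
  moreover from this have "length es = n"
    using degree_monic_char_poly[OF A] degree_linear_factors[of uminus es] by simp
  moreover have "sorted_wrt (\<ge>) es" by (simp add: es_def sorted_wrt_rev)
  ultimately show ?thesis
    by (metis decreasing_list_mset eigval_vec_def proots_linear_factors)
qed

lemma sum_largest_vec_of_list:
  assumes "sorted_wrt (\<ge>) es"
  shows "sum_largest k (vec_of_list es) = sum_list (take k es)"
  by (simp add: sum_largest_def list_vec decreasing_list_mset[OF assms])

lemma ky_fan_majorization:
  fixes A :: "real mat"
  assumes A: "A \<in> carrier_mat n n"
    and real_A: "\<exists>es. char_poly A = (\<Prod>e\<leftarrow>es. [:- e, 1:])"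
  shows "majorized n (eigval_vec A) (eigval_vec ((1 / 2) \<cdot>\<^sub>m (A + transpose_mat A)))"
proof -
  define S where "S = (1 / 2) \<cdot>\<^sub>m (A + transpose_mat A)"
  have S: "S \<in> carrier_mat n n" using A by (simp add: S_def)
  have symS: "transpose_mat S = S"
    using A by (intro eq_matI) (auto simp: S_def)
  \<comment> \<open>A symmetric matrix is symmetrized by the identity, so the spectrum of
    \<open>S\<close> is real without further assumptions.\<close>
  have pos: "0 < x \<bullet> (1\<^sub>m n *\<^sub>v x)" if "x \<in> carrier_vec n" "x \<noteq> 0\<^sub>v n" for x :: "real vec"
    using real_scalar_prod_self_pos[OF that] that(1) by simp
  have "\<exists>fs. char_poly S = (\<Prod>e\<leftarrow>fs. [:- e, 1:])"
    by (rule symmetrizable_char_poly_splits[OF S, of "1\<^sub>m n"]) (use S symS pos in auto)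
  then obtain fs where fs: "char_poly S = (\<Prod>e\<leftarrow>fs. [:- e, 1:])" "length fs = n"
    "sorted_wrt (\<ge>) fs" "eigval_vec S = vec_of_list fs"
    using eigval_vec_split[OF S] by blast
  obtain es where es: "char_poly A = (\<Prod>e\<leftarrow>es. [:- e, 1:])" "length es = n"
    "sorted_wrt (\<ge>) es" "eigval_vec A = vec_of_list es"
    using eigval_vec_split[OF A real_A] by blast
  obtain R where R: "R \<in> carrier_mat n n" "transpose_mat R * R = 1\<^sub>m n"
    and es_fs: "\<And>i. i < n \<Longrightarrow> es ! i = (\<Sum>j<n. (R $$ (j, i))\<^sup>2 * fs ! j)"
    using schur_ky_fan_doubly_stochastic[OF A es(1) fs(1)[unfolded S_def]] by blast
  note squares = orthogonal_mat_sum_squares[OF R]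
  have sum_take: "sum_list (take k xs) = (\<Sum>i<k. xs ! i)" if "k \<le> n" "length xs = n"
    for k and xs :: "real list"
    using that by (simp add: sum_list_sum_nth lessThan_atLeast0 min_def)
  \<comment> \<open>Summing over \<open>i\<close> first leaves the row sums of squares of
    \<open>R\<close>, all equal to \<open>1\<close>.\<close>
  have "(\<Sum>i<n. es ! i) = (\<Sum>i<n. \<Sum>j<n. (R $$ (j, i))\<^sup>2 * fs ! j)"
    using es_fs by simp
  also have "\<dots> = (\<Sum>j<n. (\<Sum>i<n. (R $$ (j, i))\<^sup>2) * fs ! j)"
    by (subst sum.swap) (simp add: sum_distrib_right)
  also have "\<dots> = (\<Sum>j<n. fs ! j)"
    using squares(2) by simp
  finally have total: "(\<Sum>i<n. es ! i) = (\<Sum>j<n. fs ! j)" .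
  have partial: "sum_list (take k es) \<le> sum_list (take k fs)" if "k \<le> n" for k
  proof -
    have "fs ! j \<le> fs ! i" if "i \<le> j" "j < n" for i j
      using fs(2,3) that by (cases "i = j") (auto simp: sorted_wrt_iff_nth_less)
    \<comment> \<open>The doubly stochastic matrix has \<open>(i, j)\<close> entry
      \<open>(R $$ (j, i))\<^sup>2\<close>, so its rows are the columns of \<open>R\<close> and
      conversely.\<close>
    then have "(\<Sum>i<k. \<Sum>j<n. (R $$ (j, i))\<^sup>2 * fs ! j) \<le> (\<Sum>j<k. fs ! j)"
      using squares that by (intro doubly_stochastic_partial_sum_le) auto
    then show ?thesis
      using that es_fs sum_take es(2) fs(2) by simp
  qed
  show ?thesis
    unfolding S_def[symmetric] majorized_def es(4) fs(4)
    using es(2,3) fs(2,3) total partial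
    by (auto simp: sum_largest_vec_of_list vec_of_list_index carrier_vecI)
qed

section \<open>Generalized Euclidean distance matrices\<close>

text \<open>The rows of \<open>L\<close> sum to zero because \<open>ones_vec n\<close> lies in its
  kernel, so the mixed term drops out. These row sums are the entries of the distance matrix times
  the all-ones matrix.\<close>

lemma gen_edm_row_sum:
  fixes L :: "real mat"
  assumes L: "gen_laplacian n L" and i: "i < n"
  shows "(\<Sum>j<n. a\<^sup>2 * L $$ (i, i) + b\<^sup>2 * L $$ (j, j) - 2 * a * b * L $$ (i, j))
    = real n * a\<^sup>2 * L $$ (i, i) + b\<^sup>2 * (\<Sum>j<n. L $$ (j, j))"
proof -
  have carrier: "L \<in> carrier_mat n n" and ker: "L *\<^sub>v ones_vec n = 0\<^sub>v n"
    using L by (auto simp: gen_laplacian_def psd_mat_def)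
  have "(\<Sum>j<n. L $$ (i, j)) = 0"
    using arg_cong[OF ker, of "\<lambda>v. v $ i"] carrier i
    by (simp add: ones_vec_def scalar_prod_def lessThan_atLeast0)
  then have "(\<Sum>j<n. 2 * a * b * L $$ (i, j)) = 0"
    by (simp add: sum_distrib_left[symmetric])
  then show ?thesis
    by (simp add: sum.distrib sum_subtractf sum_distrib_left)
qed

text \<open>\<open>D - D\<^sup>T\<close> and \<open>D J - J D\<^sup>T\<close> (with \<open>J = 1 1\<^sup>T\<close>) are both multiples of
  \<open>u 1\<^sup>T - 1 u\<^sup>T\<close>, where \<open>u\<close> is the diagonal of \<open>L\<close>; the weight \<open>t\<close> below makes
  \<open>D (I + t J)\<close> symmetric. The matrix \<open>I + t J\<close> has eigenvalues \<open>1\<close> and \<open>b\<^sup>2 / a\<^sup>2\<close>.\<close>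

lemma gen_edm_char_poly_splits:
  assumes "gen_edm n D"
  shows "\<exists>es. char_poly D = (\<Prod>e\<leftarrow>es. [:- e, 1:])"
proof -
  obtain a b L where D: "D \<in> carrier_mat n n" and ab: "a > 0" "b > 0" and L: "gen_laplacian n L"
    and D_entry: "\<And>i j. i < n \<Longrightarrow> j < n \<Longrightarrow>
      D $$ (i, j) = a\<^sup>2 * L $$ (i, i) + b\<^sup>2 * L $$ (j, j) - 2 * a * b * L $$ (i, j)"
    using assms unfolding gen_edm_def by blast
  have LT: "L $$ (i, j) = L $$ (j, i)" if "i < n" "j < n" for i j
    using L that unfolding gen_laplacian_def psd_mat_def
    by (metis carrier_matD index_transpose_mat(1))
  define t where "t = (b\<^sup>2 / a\<^sup>2 - 1) / real n"
  define G where "G = mat n n (\<lambda>(i, j). (if i = j then 1 else 0) + t)"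
  have G: "G \<in> carrier_mat n n" by (simp add: G_def)
  have symG: "transpose_mat G = G"
    by (intro eq_matI) (auto simp: G_def)
  have pos: "0 < x \<bullet> (G *\<^sub>v x)" if x: "x \<in> carrier_vec n" "x \<noteq> 0\<^sub>v n" for x
  proof -
    define s where "s = (\<Sum>i<n. x $ i)"
    define q where "q = (\<Sum>i<n. (x $ i)\<^sup>2)"
    obtain i where i: "i < n" "x $ i \<noteq> 0"
      using x by (metis carrier_vecD eq_vecI index_zero_vec)
    then have n: "real n > 0" by simp
    have "(G *\<^sub>v x) $ i = x $ i + t * s" if "i < n" for i
      using that x(1)
      by (simp add: G_def scalar_prod_def s_def lessThan_atLeast0 distrib_right sum.distrib
          sum_distrib_left if_distrib[of "\<lambda>c. c * _"] cong: if_cong)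
    then have "x \<bullet> (G *\<^sub>v x) = (\<Sum>i<n. x $ i * (x $ i + t * s))"
      using G by (simp add: scalar_prod_def lessThan_atLeast0)
    also have "\<dots> = q + t * s\<^sup>2"
      by (simp add: q_def s_def distrib_left sum.distrib power2_eq_square sum_distrib_left
          sum_distrib_right mult_ac)
    \<comment> \<open>This splits \<open>x\<close> along the ones vector:
      \<open>s\<^sup>2 / real n\<close> is the squared length of the projection, scaled by the
      eigenvalue \<open>b\<^sup>2 / a\<^sup>2\<close>, and the rest is the squared length of the
      orthogonal part, with eigenvalue \<open>1\<close>.\<close>
    also have "\<dots> = (q - s\<^sup>2 / real n) + b\<^sup>2 / a\<^sup>2 * s\<^sup>2 / real n"
      using n by (simp add: t_def field_simps)
    finally have form: "x \<bullet> (G *\<^sub>v x) = \<dots>" .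
    \<comment> \<open>The orthogonal part consists of the deviations from the mean
      \<open>s / real n\<close>, so its squared length is nonnegative.\<close>
    have "(\<Sum>i<n. (x $ i - s / real n)\<^sup>2) = q - 2 * (s / real n) * s + real n * (s / real n)\<^sup>2"
      by (simp add: power2_diff sum.distrib sum_subtractf q_def s_def sum_distrib_left
          sum_distrib_right sum_divide_distrib mult_ac)
    also have "\<dots> = q - s\<^sup>2 / real n"
      using n by (simp add: power2_eq_square field_simps)
    finally have var: "q - s\<^sup>2 / real n = (\<Sum>i<n. (x $ i - s / real n)\<^sup>2)" ..
    have q: "q > 0"
      unfolding q_def using i by (intro sum_pos2[of _ i]) auto
    show ?thesis
    proof (cases "s = 0")
      case True
      then show ?thesis using q form by simp
    next
      case False
      then have "b\<^sup>2 / a\<^sup>2 * s\<^sup>2 / real n > 0" using ab n by simp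
      moreover have "q - s\<^sup>2 / real n \<ge> 0"
        unfolding var by (intro sum_nonneg) auto
      ultimately show ?thesis using form by linarith
    qed
  qed
  \<comment> \<open>Apart from \<open>D\<close> itself, the product contributes \<open>t\<close>
    times a row sum of \<open>D\<close>, which depends only on \<open>i\<close>.\<close>
  have DG: "(D * G) $$ (i, j) = D $$ (i, j)
      + t * (real n * a\<^sup>2 * L $$ (i, i) + b\<^sup>2 * (\<Sum>j<n. L $$ (j, j)))"
    if "i < n" "j < n" for i j
  proof -
    have "(D * G) $$ (i, j) = D $$ (i, j) + t * (\<Sum>k<n. D $$ (i, k))"
      using that D
      by (simp add: G_def scalar_prod_def lessThan_atLeast0 distrib_left sum.distrib
          sum_distrib_left mult.commute if_distrib[of "\<lambda>c. _ * c"] if_distrib[of "\<lambda>c. c * _"] cong: if_cong)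
    also have "(\<Sum>k<n. D $$ (i, k)) = real n * a\<^sup>2 * L $$ (i, i) + b\<^sup>2 * (\<Sum>j<n. L $$ (j, j))"
      unfolding gen_edm_row_sum[OF L that(1), symmetric] using that(1)
      by (intro sum.cong) (auto simp: D_entry)
    finally show ?thesis .
  qed
  have "transpose_mat (D * G) = D * G"
  proof (rule eq_matI)
    fix i j assume "i < dim_row (D * G)" "j < dim_col (D * G)"
    then have ij: "i < n" "j < n" using D G by auto
    then have "t * real n = b\<^sup>2 / a\<^sup>2 - 1" by (simp add: t_def)
    \<comment> \<open>This identity dictates the choice of \<open>t\<close>: it raises the
      coefficient of \<open>L $$ (i, i)\<close> in \<open>(D * G) $$ (i, j)\<close> from
      \<open>a\<^sup>2\<close> to \<open>b\<^sup>2\<close>, the coefficient of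
      \<open>L $$ (j, j)\<close>, so the entry becomes symmetric in \<open>i\<close> and
      \<open>j\<close>.\<close>
    then have t: "t * real n * a\<^sup>2 = b\<^sup>2 - a\<^sup>2"
      using ab by (simp add: field_simps)
    have expand: "t * (real n * a\<^sup>2 * y + z) = (t * real n * a\<^sup>2) * y + t * z" for y z
      by (simp add: algebra_simps)
    have "transpose_mat (D * G) $$ (i, j) = (D * G) $$ (j, i)"
      using ij D G by simp
    also have "\<dots> = (D * G) $$ (i, j)"
      unfolding DG[OF ij] DG[OF ij(2,1)] expand t D_entry[OF ij] D_entry[OF ij(2,1)] LT[OF ij]
      by (simp add: algebra_simps)
    finally show "transpose_mat (D * G) $$ (i, j) = (D * G) $$ (i, j)" .
  qed (use D G in auto)
  from symmetrizable_char_poly_splits[OF D G symG pos this] show ?thesis .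
qed

theorem theorem2p21:
  fixes n :: nat and D :: "real mat"
  assumes "gen_edm n D"
    and "D \<noteq> 0\<^sub>m n n"
  shows "majorized n (eigval_vec D) (eigval_vec ((1 / 2) \<cdot>\<^sub>m (D + transpose_mat D)))"
proof (rule ky_fan_majorization)
  show "D \<in> carrier_mat n n"
    using assms(1) by (simp add: gen_edm_def)
  show "\<exists>es. char_poly D = (\<Prod>e\<leftarrow>es. [:- e, 1:])"
    using assms(1) by (rule gen_edm_char_poly_splits)
qed

end
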